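(* The facet complex $\Delta=\{H_1,H_2,H_3,H_4,H_5\}$ on the vertices $x_1,\dots,x_6$ with $$H_1=\{x_2,x_6\},\quad H_2=\{x_1,x_2,x_3\},\quad H_3=\{x_1,x_3,x_4\},\quad H_4=\{x_1,x_4,x_5\},\quad H_5=\{x_5,x_6\}$$ is odd-cycle-free but not Mengerian. In particular, odd-cycle-free facet complexes are not necessarily Mengerian.
   Context: A facet complex over a finite vertex set $V$ is a set $\Delta$ of subsets of $V$ such that $F,G\in\Delta$ and $F\subseteq G$ imply $F=G$; its elements are called facets. Any subset of $\Delta$ is again a facet complex. A facet $F$ of a facet complex $\Delta$ is a leaf of $\Delta$ if either $F$ is the only facet of $\Delta$, or there exists $G\in\Delta\setminus\{F\}$ such that $H\cap F\subseteq G$ for all $H\in\Delta\setminus\{F\}$. A nonempty facet complex is a (simplicial) cycle if it has no leaf but every nonempty proper subset of it has a leaf; its length is its number of facets. A facet complex $\Delta$ is odd-cycle-free if no subset of $\Delta$ is a cycle of odd length. For a facet complex with $q$ facets on $n$ vertices, let $M$ be its $q\times n$ incidence matrix (rows indexed by facets, columns by vertices, entry $1$ if the vertex lies in the facet and $0$ otherwise). The complex is Mengerian if for every vector $\mathbf{c}\in\mathbb{Z}_{\ge 0}^n$, $$\min\{\mathbf{a}\cdot\mathbf{c}\mid \mathbf{a}\in\mathbb{Z}_{\ge0}^n,\ M\mathbf{a}\ge\mathbf{1}\}=\max\{\mathbf{b}\cdot\mathbf{1}\mid \mathbf{b}\in\mathbb{Z}_{\ge0}^q,\ M^T\mathbf{b}\le\mathbf{c}\},$$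 where $\mathbf 1$ is the all-ones vector and inequalities are componentwise. *)

theory Defs
  imports Main
begin

definition facet_complex :: "'a set \<Rightarrow> 'a set set \<Rightarrow> bool" where
  "facet_complex V \<Delta> \<longleftrightarrow>
     finite V \<and> \<Delta> \<subseteq> Pow V \<and> (\<forall>F\<in>\<Delta>. \<forall>G\<in>\<Delta>. F \<subseteq> G \<longrightarrow> F = G)"

definition is_leaf :: "'a set \<Rightarrow> 'a set set \<Rightarrow> bool" where
  "is_leaf F \<Delta> \<longleftrightarrow>
     F \<in> \<Delta> \<and> (\<Delta> = {F} \<or> (\<exists>G\<in>\<Delta> - {F}. \<forall>H\<in>\<Delta> - {F}. H \<inter> F \<subseteq> G))"

definition simplicial_cycle :: "'a set set \<Rightarrow> bool" where
  "simplicial_cycle \<Delta> \<longleftrightarrow>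
     \<Delta> \<noteq> {} \<and> (\<nexists>F. is_leaf F \<Delta>) \<and>
     (\<forall>\<Gamma>. \<Gamma> \<noteq> {} \<and> \<Gamma> \<subset> \<Delta> \<longrightarrow> (\<exists>F. is_leaf F \<Gamma>))"

definition odd_cycle_free :: "'a set set \<Rightarrow> bool" where
  "odd_cycle_free \<Delta> \<longleftrightarrow>
     \<not> (\<exists>\<Gamma>. \<Gamma> \<subseteq> \<Delta> \<and> simplicial_cycle \<Gamma> \<and> odd (card \<Gamma>))"

text \<open>
  Rows of the incidence matrix are indexed by the facets themselves and columns by the
  vertices, so a vector of length \<open>n\<close> is a function on vertices (only its values on \<open>V\<close> are
  used) and a vector of length \<open>q\<close> is a function on facets (only its values on \<open>\<Delta>\<close> are used).
\<close>

definition incidence :: "'a set \<Rightarrow> 'a \<Rightarrow> nat" where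
  "incidence F v = (if v \<in> F then 1 else 0)"

definition cover_values :: "'a set \<Rightarrow> 'a set set \<Rightarrow> ('a \<Rightarrow> nat) \<Rightarrow> nat set" where
  "cover_values V \<Delta> c =
     {\<Sum>v\<in>V. a v * c v | a. \<forall>F\<in>\<Delta>. (\<Sum>v\<in>V. incidence F v * a v) \<ge> 1}"

definition packing_values :: "'a set \<Rightarrow> 'a set set \<Rightarrow> ('a \<Rightarrow> nat) \<Rightarrow> nat set" where
  "packing_values V \<Delta> c =
     {\<Sum>F\<in>\<Delta>. b F | b. \<forall>v\<in>V. (\<Sum>F\<in>\<Delta>. incidence F v * b F) \<le> c v}"

definition is_minimum :: "nat set \<Rightarrow> nat \<Rightarrow> bool" where
  "is_minimum S m \<longleftrightarrow> m \<in> S \<and> (\<forall>s\<in>S. m \<le> s)"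

definition is_maximum :: "nat set \<Rightarrow> nat \<Rightarrow> bool" where
  "is_maximum S m \<longleftrightarrow> m \<in> S \<and> (\<forall>s\<in>S. s \<le> m)"

text \<open>
  The equation ``min = max'' is read as: both extrema exist and they coincide. Existence is
  automatic unless the empty set is a facet; see the two lemmas at the end.
\<close>

definition mengerian :: "'a set \<Rightarrow> 'a set set \<Rightarrow> bool" where
  "mengerian V \<Delta> \<longleftrightarrow>
     (\<forall>c. \<exists>m. is_minimum (cover_values V \<Delta> c) m \<and> is_maximum (packing_values V \<Delta> c) m)"

lemma cover_minimum_exists:
  assumes "facet_complex V \<Delta>" and "{} \<notin> \<Delta>"
  shows "\<exists>m. is_minimum (cover_values V \<Delta> c) m"
proof -
  have "(\<Sum>v\<in>V. incidence F v * (1::nat)) \<ge> 1" if "F \<in> \<Delta>" for F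
  proof -
    obtain v where v: "v \<in> F" using assms(2) \<open>F \<in> \<Delta>\<close> by (cases "F = {}") auto
    have "v \<in> V" "finite V" using assms(1) \<open>F \<in> \<Delta>\<close> v by (auto simp: facet_complex_def)
    then have "incidence F v * 1 \<le> (\<Sum>v\<in>V. incidence F v * (1::nat))"
      by (intro member_le_sum) auto
    then show ?thesis using v by (simp add: incidence_def)
  qed
  then have "(\<Sum>v\<in>V. (\<lambda>_. 1) v * c v) \<in> cover_values V \<Delta> c"
    unfolding cover_values_def by (intro CollectI exI[of _ "\<lambda>_. 1"]) simp
  then obtain k where "k \<in> cover_values V \<Delta> c" ..
  then show ?thesis
    unfolding is_minimum_def
    by (intro exI[of _ "LEAST m. m \<in> cover_values V \<Delta> c"]) (auto intro: LeastI Least_le)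
qed

lemma packing_maximum_exists:
  assumes "facet_complex V \<Delta>" and "{} \<notin> \<Delta>"
  shows "\<exists>m. is_maximum (packing_values V \<Delta> c) m"
proof -
  have fin: "finite V" "finite \<Delta>"
    using assms(1) by (auto simp: facet_complex_def intro: finite_subset)
  have bnd: "s \<le> card \<Delta> * (\<Sum>v\<in>V. c v)" if s: "s \<in> packing_values V \<Delta> c" for s
  proof -
    obtain b where b: "s = (\<Sum>F\<in>\<Delta>. b F)"
      "\<And>v. v \<in> V \<Longrightarrow> (\<Sum>F\<in>\<Delta>. incidence F v * b F) \<le> c v"
      using s by (auto simp: packing_values_def)
    have "b F \<le> (\<Sum>v\<in>V. c v)" if F: "F \<in> \<Delta>" for F
    proof -
      obtain v where v: "v \<in> F" using assms(2) F by (cases "F = {}") auto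
      have vV: "v \<in> V" using assms(1) F v by (auto simp: facet_complex_def)
      have "b F = incidence F v * b F" using v by (simp add: incidence_def)
      also have "\<dots> \<le> (\<Sum>F\<in>\<Delta>. incidence F v * b F)"
        using F fin by (intro member_le_sum) auto
      also have "\<dots> \<le> c v" using b(2) vV .
      also have "\<dots> \<le> (\<Sum>v\<in>V. c v)" using vV fin by (intro member_le_sum) auto
      finally show ?thesis .
    qed
    then show ?thesis
      using sum_bounded_above[of \<Delta> b "\<Sum>v\<in>V. c v"] b(1) by simp
  qed
  have "(\<Sum>F\<in>\<Delta>. (\<lambda>_. 0::nat) F) \<in> packing_values V \<Delta> c"
    unfolding packing_values_def by (intro CollectI exI[of _ "\<lambda>_. 0"]) simp
  then have "packing_values V \<Delta> c \<noteq> {}" by blast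
  moreover have "finite (packing_values V \<Delta> c)"
    using bnd by (auto simp: finite_nat_set_iff_bounded_le)
  ultimately show ?thesis
    unfolding is_maximum_def by (intro exI[of _ "Max (packing_values V \<Delta> c)"]) simp
qed

end

(* Without x_1 the facets are the edges of a pentagon. Give x_1 weight 2 and the other vertices
   weight 1. The pentagon allows no packing of size 3. A cover without x_1 covers the pentagon and
   costs at least 3, and one with x_1 costs 2 and still needs a vertex of H_1. So min = 3, max = 2.
   The whole complex has no leaf, but it is not a cycle: since x_1 lies in H_2 and in H_4, the
   proper subset H_1, H_2, H_4, H_5 has no leaf either. Every leafless nonempty subset contains
   these four facets. *)
theory Submission
  imports Defs
begin

text \<open>In a chain a maximal trace on \<open>F\<close> is the greatest one, so a facet
  \<open>G\<close> with that trace absorbs the traces of all the others. The contrapositive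
  restricts which subsets can be leafless.\<close>

lemma is_leaf_if_intersections_chain:
  assumes "finite \<Gamma>" "F \<in> \<Gamma>"
    and chain: "\<And>H K. H \<in> \<Gamma> - {F} \<Longrightarrow> K \<in> \<Gamma> - {F} \<Longrightarrow> H \<inter> F \<subseteq> K \<inter> F \<or> K \<inter> F \<subseteq> H \<inter> F"
  shows "is_leaf F \<Gamma>"
proof (cases "\<Gamma> = {F}")
  case True
  then show ?thesis by (simp add: is_leaf_def)
next
  case False
  let ?I = "(\<lambda>H. H \<inter> F) ` (\<Gamma> - {F})"
  have "finite ?I" "?I \<noteq> {}"
    using assms(1,2) False by auto
  then obtain M where M: "M \<in> ?I" "\<forall>N\<in>?I. M \<subseteq> N \<longrightarrow> M = N"
    using finite_has_maximal[of ?I] by blast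
  then obtain G where G: "G \<in> \<Gamma> - {F}" "M = G \<inter> F"
    by (elim imageE)
  have "H \<inter> F \<subseteq> G" if H: "H \<in> \<Gamma> - {F}" for H
  proof -
    have "M \<subseteq> H \<inter> F \<Longrightarrow> M = H \<inter> F"
      using M(2) H by (meson image_eqI)
    then have "H \<inter> F \<subseteq> M"
      using chain[OF H G(1)] G(2) by (metis order_refl)
    then show ?thesis
      using G(2) by simp
  qed
  with G(1) have "\<exists>G\<in>\<Gamma> - {F}. \<forall>H\<in>\<Gamma> - {F}. H \<inter> F \<subseteq> G"
    by (intro bexI[of _ G] ballI)
  then show ?thesis
    using assms(2) by (simp add: is_leaf_def)
qed

text \<open>Between facets \<open>G \<noteq> F\<close> amounts to
  \<open>\<not> G \<subseteq> F\<close>. With inclusions only, and \<open>F\<close> quantified over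
  all of \<open>\<Gamma>\<close>, the third hypothesis becomes a finite check on vertices once the
  facets are explicit sets.\<close>

lemma facet_complex_not_is_leaf:
  assumes "facet_complex V \<Gamma>" "\<Gamma> \<noteq> {F}"
    and "\<forall>F\<in>\<Gamma>. \<forall>G\<in>\<Gamma>. \<not> G \<subseteq> F \<longrightarrow> (\<exists>H\<in>\<Gamma>. \<not> H \<subseteq> F \<and> \<not> H \<inter> F \<subseteq> G)"
  shows "\<not> is_leaf F \<Gamma>"
proof
  assume "is_leaf F \<Gamma>"
  then obtain G where G: "F \<in> \<Gamma>" "G \<in> \<Gamma>" "G \<noteq> F" "\<forall>H\<in>\<Gamma> - {F}. H \<inter> F \<subseteq> G"
    using assms(2) unfolding is_leaf_def by blast
  have "\<not> G \<subseteq> F"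
    using assms(1) G(1-3) unfolding facet_complex_def by metis
  then obtain H where "H \<in> \<Gamma>" "\<not> H \<subseteq> F" "\<not> H \<inter> F \<subseteq> G"
    using assms(3) G(1,2) by meson
  then show False
    using G(4) by blast
qed

theorem mainTheorem3:
  fixes H1 H2 H3 H4 H5 V :: "nat set" and \<Delta> :: "nat set set"
  assumes "V = {1, 2, 3, 4, 5, 6}"
    and "H1 = {2, 6}" and "H2 = {1, 2, 3}" and "H3 = {1, 3, 4}"
    and "H4 = {1, 4, 5}" and "H5 = {5, 6}"
    and "\<Delta> = {H1, H2, H3, H4, H5}"
  shows "(facet_complex V \<Delta> \<and> odd_cycle_free \<Delta> \<and> \<not> mengerian V \<Delta>) \<and>
    \<not> (\<forall>(W :: nat set) \<Gamma>. facet_complex W \<Gamma> \<and> odd_cycle_free \<Gamma> \<longrightarrow> mengerian W \<Gamma>)"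
proof -
  note H = assms(2-6)
  have distinct: "H1 \<noteq> H2" "H1 \<noteq> H3" "H1 \<noteq> H4" "H1 \<noteq> H5" "H2 \<noteq> H3" "H2 \<noteq> H4" "H2 \<noteq> H5"
    "H3 \<noteq> H4" "H3 \<noteq> H5" "H4 \<noteq> H5"
    unfolding H by (simp_all add: insert_eq_iff doubleton_eq_iff)

  have fc: "facet_complex V \<Delta>"
    unfolding facet_complex_def assms by simp

  have no_leaf: "\<not> is_leaf F {H1, H2, H4, H5}" for F
  proof (rule facet_complex_not_is_leaf)
    show "facet_complex V {H1, H2, H4, H5}"
      unfolding facet_complex_def assms by simp
    show "{H1, H2, H4, H5} \<noteq> {F}"
      using distinct(1) by blast
  \<comment> \<open>The four facets form a closed chain: consecutive ones share exactly the vertices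
    2, 1, 5, 6 in turn, and opposite ones are disjoint. So no facet contains both shared vertices of
    another.\<close>
  qed (simp add: H)

  have ocf: "odd_cycle_free \<Delta>"
    unfolding odd_cycle_free_def
  proof
    assume "\<exists>\<Gamma>. \<Gamma> \<subseteq> \<Delta> \<and> simplicial_cycle \<Gamma> \<and> odd (card \<Gamma>)"
    then obtain \<Gamma> where \<Gamma>: "\<Gamma> \<subseteq> \<Delta>" "simplicial_cycle \<Gamma>" "odd (card \<Gamma>)" by blast
    have fin: "finite \<Gamma>"
      using \<Gamma>(1) unfolding assms(7) by (rule finite_subset) simp
    \<comment> \<open>Enlarging \<open>\<Gamma> - {F}\<close> to a known set \<open>B\<close> lets
      the incomparable traces be sought in an explicit list, although \<open>\<Gamma>\<close> itself
      is unknown.\<close>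
    have not_chain: "\<exists>H\<in>B. \<exists>K\<in>B. \<not> (H \<inter> F \<subseteq> K \<inter> F \<or> K \<inter> F \<subseteq> H \<inter> F)"
      if "F \<in> \<Gamma>" "\<Gamma> - {F} \<subseteq> B" for F B
    proof (rule ccontr)
      assume "\<not> ?thesis"
      then have "is_leaf F \<Gamma>"
        using that(2) by (intro is_leaf_if_intersections_chain[OF fin that(1)]) blast
      then show False
        using \<Gamma>(2) unfolding simplicial_cycle_def by blast
    qed
    have sub: "H = H1 \<or> H = H2 \<or> H = H3 \<or> H = H4 \<or> H = H5" if "H \<in> \<Gamma>" for H
      using that \<Gamma>(1) unfolding assms(7) by blast
    \<comment> \<open>Each of the seven implications holds because, with the named facet missing,
      the remaining traces form a chain. For \<open>H2\<close> without \<open>H1\<close> they are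
      {1, 3}, {1} and the empty set.\<close>
    have "H2 \<in> \<Gamma>" if "H1 \<in> \<Gamma>"
    proof (rule ccontr)
      assume "H2 \<notin> \<Gamma>"
      then have "\<Gamma> - {H1} \<subseteq> {H3, H4, H5}" using sub by blast
      from not_chain[OF that this] show False by (simp add: H)
    qed
    moreover have "H5 \<in> \<Gamma>" if "H1 \<in> \<Gamma>"
    proof (rule ccontr)
      assume "H5 \<notin> \<Gamma>"
      then have "\<Gamma> - {H1} \<subseteq> {H2, H3, H4}" using sub by blast
      from not_chain[OF that this] show False by (simp add: H)
    qed
    moreover have "H1 \<in> \<Gamma>" if "H2 \<in> \<Gamma>"
    proof (rule ccontr)
      assume "H1 \<notin> \<Gamma>"
      then have "\<Gamma> - {H2} \<subseteq> {H3, H4, H5}" using sub by blast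
      from not_chain[OF that this] show False by (simp add: H)
    qed
    moreover have "H2 \<in> \<Gamma>" if "H3 \<in> \<Gamma>"
    proof (rule ccontr)
      assume "H2 \<notin> \<Gamma>"
      then have "\<Gamma> - {H3} \<subseteq> {H1, H4, H5}" using sub by blast
      from not_chain[OF that this] show False by (simp add: H)
    qed
    moreover have "H5 \<in> \<Gamma>" if "H4 \<in> \<Gamma>"
    proof (rule ccontr)
      assume "H5 \<notin> \<Gamma>"
      then have "\<Gamma> - {H4} \<subseteq> {H1, H2, H3}" using sub by blast
      from not_chain[OF that this] show False by (simp add: H)
    qed
    moreover have "H1 \<in> \<Gamma>" if "H5 \<in> \<Gamma>"
    proof (rule ccontr)
      assume "H1 \<notin> \<Gamma>"
      then have "\<Gamma> - {H5} \<subseteq> {H2, H3, H4}" using sub by blast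
      from not_chain[OF that this] show False by (simp add: H)
    qed
    moreover have "H4 \<in> \<Gamma>" if "H5 \<in> \<Gamma>"
    proof (rule ccontr)
      assume "H4 \<notin> \<Gamma>"
      then have "\<Gamma> - {H5} \<subseteq> {H1, H2, H3}" using sub by blast
      from not_chain[OF that this] show False by (simp add: H)
    qed
    moreover have "\<Gamma> \<noteq> {}"
      using \<Gamma>(2) unfolding simplicial_cycle_def by blast
    \<comment> \<open>Whichever facet \<open>\<Gamma>\<close> contains, the implications lead to all
      four: \<open>H3\<close> forces \<open>H2\<close>, and from there they run through
      \<open>H1\<close> and \<open>H5\<close> to \<open>H4\<close>.\<close>
    ultimately have four: "{H1, H2, H4, H5} \<subseteq> \<Gamma>"
      using sub by blast
    have "card {H1, H2, H4, H5} = 4"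
      using distinct by simp
    \<comment> \<open>Parity makes the inclusion proper, and then the minimality of a cycle is
      violated.\<close>
    then have "\<Gamma> \<noteq> {H1, H2, H4, H5}"
      using \<Gamma>(3) by (metis even_numeral)
    with four have "{H1, H2, H4, H5} \<subset> \<Gamma>" by (simp add: psubset_eq)
    moreover have "\<exists>F. is_leaf F \<Gamma>'" if "\<Gamma>' \<noteq> {}" "\<Gamma>' \<subset> \<Gamma>" for \<Gamma>'
      using \<Gamma>(2) that unfolding simplicial_cycle_def by blast
    ultimately show False
      using no_leaf by (metis insert_not_empty)
  qed

  have not_mengerian: "\<not> mengerian V \<Delta>"
  proof
    assume "mengerian V \<Delta>"
    define c :: "nat \<Rightarrow> nat" where "c v = (if v = 1 then 2 else 1)" for v
    obtain m where "is_minimum (cover_values V \<Delta> c) m" "is_maximum (packing_values V \<Delta> c) m"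
      using \<open>mengerian V \<Delta>\<close> unfolding mengerian_def by blast
    then have cover: "m \<in> cover_values V \<Delta> c" and packing: "m \<in> packing_values V \<Delta> c"
      by (auto simp: is_minimum_def is_maximum_def)
    obtain a where "m = (\<Sum>v\<in>V. a v * c v)"
      and "\<forall>F\<in>\<Delta>. (\<Sum>v\<in>V. incidence F v * a v) \<ge> 1"
      using cover unfolding cover_values_def by blast
    then have "m = 2 * a 1 + a 2 + a 3 + a 4 + a 5 + a 6"
      and "a 2 + a 6 \<ge> 1" "a 1 + a 2 + a 3 \<ge> 1" "a 1 + a 3 + a 4 \<ge> 1"
        "a 1 + a 4 + a 5 \<ge> 1" "a 5 + a 6 \<ge> 1"
      unfolding assms by (simp_all add: incidence_def c_def)
    \<comment> \<open>The five covering constraints add up to \<open>2 * m \<ge> 5 + a 1\<close>,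
      and integrality rounds up.\<close>
    then have "m \<ge> 3" by linarith
    obtain b where "m = (\<Sum>F\<in>\<Delta>. b F)"
      and "\<forall>v\<in>V. (\<Sum>F\<in>\<Delta>. incidence F v * b F) \<le> c v"
      using packing unfolding packing_values_def by blast
    moreover have "(\<Sum>F\<in>\<Delta>. f F) = f H1 + f H2 + f H3 + f H4 + f H5" for f :: "nat set \<Rightarrow> nat"
      using distinct unfolding assms(7) by simp
    ultimately have "m = b H1 + b H2 + b H3 + b H4 + b H5"
      and "b H1 + b H2 \<le> 1" "b H2 + b H3 \<le> 1" "b H3 + b H4 \<le> 1" "b H4 + b H5 \<le> 1"
        "b H1 + b H5 \<le> 1"
      unfolding assms(1) by (simp_all add: incidence_def c_def H)
    \<comment> \<open>Every facet occurs in exactly two of the five constraints, so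
      \<open>2 * m \<le> 5\<close>, and integrality rounds down.\<close>
    then have "m \<le> 2" by linarith
    with \<open>m \<ge> 3\<close> show False by simp
  qed

  show ?thesis
    using fc ocf not_mengerian by blast
qed

end
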